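(* Let $G$ be a finite group with Fitting subgroup $F(G)$. Suppose that $C_G(F(G)) \le F(G)$ and that $[x, F(G)]$ is a normal subset of $F(G)$ for every small element $x$ of $G$. Then $M(G)$ is nilpotent of class at most $2$.
   Context: For a finite group $G$, an element $x \in G$ is called small if $x$ is non-central and its conjugacy class has the smallest size among all conjugacy classes of non-central elements of $G$. $M(G)$ denotes the subgroup of $G$ generated by all small elements of $G$ (trivial if there are none). $F(G)$ denotes the Fitting subgroup of $G$ and $C_G(H)$ the centralizer of $H$ in $G$. Commutators are $[x,h] = x^{-1}h^{-1}xh$. For $x \in G$ and a subgroup $H \le G$, $[x,H]$ denotes the set $\{[x,h] : h \in H\}$ (a set, not the subgroup it generates). A subset $S$ of a group $H$ is normal (in $H$) if $h^{-1}Sh = S$ for all $h \in H$. *)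

theory Defs
  imports "HOL-Algebra.Algebra"
begin

definition centralizer :: "('a, 'b) monoid_scheme \<Rightarrow> 'a set \<Rightarrow> 'a set" where
  "centralizer G S = {g \<in> carrier G. \<forall>s \<in> S. g \<otimes>\<^bsub>G\<^esub> s = s \<otimes>\<^bsub>G\<^esub> g}"

definition group_center :: "('a, 'b) monoid_scheme \<Rightarrow> 'a set" where
  "group_center G = centralizer G (carrier G)"

definition conj_class :: "('a, 'b) monoid_scheme \<Rightarrow> 'a \<Rightarrow> 'a set" where
  "conj_class G x = (\<lambda>g. inv\<^bsub>G\<^esub> g \<otimes>\<^bsub>G\<^esub> x \<otimes>\<^bsub>G\<^esub> g) ` carrier G"

(* The abbreviation derived_set of HOL-Algebra uses the other convention,
   x h x^-1 h^-1, for the commutator. *)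
definition commutator :: "('a, 'b) monoid_scheme \<Rightarrow> 'a \<Rightarrow> 'a \<Rightarrow> 'a" where
  "commutator G x h = inv\<^bsub>G\<^esub> x \<otimes>\<^bsub>G\<^esub> inv\<^bsub>G\<^esub> h \<otimes>\<^bsub>G\<^esub> x \<otimes>\<^bsub>G\<^esub> h"

(* This is the bare set [x, H], not the subgroup it generates. *)
definition commutator_set :: "('a, 'b) monoid_scheme \<Rightarrow> 'a \<Rightarrow> 'a set \<Rightarrow> 'a set" where
  "commutator_set G x H = commutator G x ` H"

definition normal_subset :: "('a, 'b) monoid_scheme \<Rightarrow> 'a set \<Rightarrow> 'a set \<Rightarrow> bool" where
  "normal_subset G H S \<longleftrightarrow>
     S \<subseteq> H \<and> (\<forall>h \<in> H. (\<lambda>s. inv\<^bsub>G\<^esub> h \<otimes>\<^bsub>G\<^esub> s \<otimes>\<^bsub>G\<^esub> h) ` S = S)"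

(* Indexed from 0: lower_central G n is the term usually written gamma_(n+1). *)
primrec lower_central :: "('a, 'b) monoid_scheme \<Rightarrow> nat \<Rightarrow> 'a set" where
  "lower_central G 0 = carrier G"
| "lower_central G (Suc n) =
     generate G {commutator G a g | a g. a \<in> lower_central G n \<and> g \<in> carrier G}"

definition nilpotent_group :: "('a, 'b) monoid_scheme \<Rightarrow> bool" where
  "nilpotent_group G \<longleftrightarrow> group G \<and> (\<exists>n. lower_central G n = {\<one>\<^bsub>G\<^esub>})"

(* Meaningful only for nilpotent groups, since LEAST is otherwise unspecified. *)
definition nilpotency_class :: "('a, 'b) monoid_scheme \<Rightarrow> nat" where
  "nilpotency_class G = (LEAST n. lower_central G n = {\<one>\<^bsub>G\<^esub>})"

(* For finite groups this is the largest nilpotent normal subgroup. *)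
definition fitting_subgroup :: "('a, 'b) monoid_scheme \<Rightarrow> 'a set" where
  "fitting_subgroup G =
     generate G (\<Union>{N. N \<lhd> G \<and> nilpotent_group (G\<lparr>carrier := N\<rparr>)})"

definition small_element :: "('a, 'b) monoid_scheme \<Rightarrow> 'a \<Rightarrow> bool" where
  "small_element G x \<longleftrightarrow>
     x \<in> carrier G - group_center G \<and>
     (\<forall>y \<in> carrier G - group_center G. card (conj_class G x) \<le> card (conj_class G y))"

definition small_subgroup :: "('a, 'b) monoid_scheme \<Rightarrow> 'a set" where
  "small_subgroup G = generate G {x. small_element G x}"

end

theory Submission
  imports Defs
begin

text \<open>
Write \<open>F\<close> for the Fitting subgroup, \<open>Z\<close> for the center, \<open>M\<close> for the subgroup generated by the
small elements and \<open>C(g)\<close> for the centralizer of an element \<open>g\<close>.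

The heart of the matter is that \<open>[x, F] \<subseteq> Z\<close> for every small \<open>x\<close>
(\<open>commutator_with_small_element_central\<close>). Let \<open>K\<close> be the set \<open>[x, F]\<close>. Both \<open>C(x)\<close> and \<open>F\<close> act
on \<open>K\<close> by conjugation, \<open>C(x)\<close> because \<open>F\<close> is normal in \<open>G\<close> and \<open>F\<close> because \<open>K\<close> is a normal subset,
so the product \<open>C(x) F\<close> acts on \<open>K\<close>. As \<open>K\<close> is a translate of the set of \<open>F\<close>-conjugates of \<open>x\<close>,
this product has at least \<open>|C(x)| |K|\<close> elements. If \<open>y \<in> K\<close> is non-central, its orbit under
\<open>C(x) F\<close> avoids \<open>1 \<in> K\<close> and so has fewer than \<open>|K|\<close> elements; hence more than \<open>|C(x)|\<close> elements
of the product fix \<open>y\<close>, and the class of \<open>y\<close> is smaller than that of \<open>x\<close>. This contradicts the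
smallness of \<open>x\<close>.

Let \<open>S\<close> be the set of all \<open>g\<close> with \<open>[g, F] \<subseteq> Z\<close>, a normal subgroup of \<open>G\<close>. It
contains every small element, hence \<open>M\<close>. Two elements of \<open>S\<close> act on \<open>F\<close> by multiplication with central elements, so their actions
commute and \<open>[S, S]\<close> centralizes \<open>F\<close>. By hypothesis \<open>[S, S] \<subseteq> F\<close>, whence
\<open>[S, S, S] \<subseteq> [F, S] \<subseteq> Z\<close> and \<open>S\<close> is nilpotent. Being normal as well, \<open>S\<close> lies in \<open>F\<close>
(\<open>centralizer_mod_center_fitting_subset\<close>). This improves the bound on the class: now
\<open>[M, M] \<subseteq> [S, F] \<subseteq> Z\<close>, so \<open>M\<close> has class at most 2.
\<close>

section \<open>Conjugation, centralizers and commutators\<close>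

context group
begin

abbreviation conj_by :: "'a \<Rightarrow> 'a \<Rightarrow> 'a" where
  "conj_by x g \<equiv> inv g \<otimes> x \<otimes> g"

lemma cancel_inv_left:
  assumes "a \<in> carrier G" "b \<in> carrier G"
  shows "inv a \<otimes> (a \<otimes> b) = b" and "a \<otimes> (inv a \<otimes> b) = b"
  using assms by (simp_all flip: m_assoc)

lemmas word_simps = m_assoc inv_mult_group cancel_inv_left

lemma conj_by_mult:
  assumes "x \<in> carrier G" "a \<in> carrier G" "b \<in> carrier G"
  shows "conj_by x (a \<otimes> b) = conj_by (conj_by x a) b"
  using assms by (simp add: word_simps)

lemma conj_by_inv_cancel:
  assumes "x \<in> carrier G" "a \<in> carrier G"
  shows "conj_by (conj_by x a) (inv a) = x"
  using assms by (simp add: word_simps)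

lemma mem_centralizer_singleton_iff:
  assumes "x \<in> carrier G"
  shows "g \<in> centralizer G {x} \<longleftrightarrow> g \<in> carrier G \<and> conj_by x g = x"
proof (cases "g \<in> carrier G")
  case True
  have "conj_by x g = x \<longleftrightarrow> g \<otimes> x = x \<otimes> g"
    using inv_solve_left'[of x g "x \<otimes> g"] assms True by (auto simp: m_assoc)
  then show ?thesis using True by (simp add: centralizer_def)
qed (simp add: centralizer_def)

lemma subgroup_centralizer:
  assumes "S \<subseteq> carrier G"
  shows "subgroup (centralizer G S) G"
proof (rule subgroupI)
  fix a assume a: "a \<in> centralizer G S"
  have "inv a \<otimes> s = s \<otimes> inv a" if "s \<in> S" for s
  proof -
    have c: "a \<in> carrier G" "s \<in> carrier G" "a \<otimes> s = s \<otimes> a"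
      using a that assms by (auto simp: centralizer_def)
    have "inv a \<otimes> s = inv a \<otimes> (s \<otimes> a) \<otimes> inv a"
      using c by (simp add: m_assoc)
    also have "\<dots> = inv a \<otimes> (a \<otimes> s) \<otimes> inv a" using c by simp
    also have "\<dots> = s \<otimes> inv a" using c(1,2) by (simp add: m_assoc cancel_inv_left)
    finally show ?thesis .
  qed
  then show "inv a \<in> centralizer G S"
    using a by (auto simp: centralizer_def)
next
  fix a b assume ab: "a \<in> centralizer G S" "b \<in> centralizer G S"
  have "a \<otimes> b \<otimes> s = s \<otimes> (a \<otimes> b)" if "s \<in> S" for s
  proof -
    have c: "a \<in> carrier G" "b \<in> carrier G" "s \<in> carrier G"
      "a \<otimes> s = s \<otimes> a" "b \<otimes> s = s \<otimes> b"
      using ab that assms by (auto simp: centralizer_def)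
    then show ?thesis by (metis m_assoc)
  qed
  then show "a \<otimes> b \<in> centralizer G S"
    using ab by (auto simp: centralizer_def)
next
  show "centralizer G S \<noteq> {}"
    using assms by (auto simp: centralizer_def intro!: exI[of _ \<one>])
qed (auto simp: centralizer_def)

lemma subgroup_group_center: "subgroup (group_center G) G"
  unfolding group_center_def by (rule subgroup_centralizer) simp

lemma group_center_commute:
  assumes "z \<in> group_center G" "g \<in> carrier G"
  shows "z \<otimes> g = g \<otimes> z"
  using assms by (simp add: group_center_def centralizer_def)

lemma group_center_conj_by:
  assumes "z \<in> group_center G" "g \<in> carrier G"
  shows "conj_by z g = z"
proof -
  have "z \<in> carrier G" using assms by (simp add: group_center_def centralizer_def)
  then show ?thesis
    using assms by (simp add: m_assoc group_center_commute cancel_inv_left)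
qed

lemma commutator_closed [simp]:
  "a \<in> carrier G \<Longrightarrow> b \<in> carrier G \<Longrightarrow> commutator G a b \<in> carrier G"
  by (simp add: commutator_def)

lemma commutator_eq_iff:
  assumes "a \<in> carrier G" "b \<in> carrier G" "z \<in> carrier G"
  shows "commutator G a b = z \<longleftrightarrow> a \<otimes> b = b \<otimes> a \<otimes> z"
proof -
  have "commutator G a b = inv (b \<otimes> a) \<otimes> (a \<otimes> b)"
    using assms by (simp add: commutator_def m_assoc inv_mult_group)
  then show ?thesis
    using assms by (metis inv_solve_left m_closed)
qed

lemma commutator_swap:
  assumes "a \<in> carrier G" "b \<in> carrier G"
  shows "commutator G b a = inv (commutator G a b)"
  using assms by (simp add: commutator_def word_simps)

lemma commutator_conj_by:
  assumes "a \<in> carrier G" "b \<in> carrier G" "g \<in> carrier G"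
  shows "conj_by (commutator G a b) g = commutator G (conj_by a g) (conj_by b g)"
  using assms by (simp add: commutator_def word_simps)

lemma commutator_eq_conj_by:
  assumes "a \<in> carrier G" "b \<in> carrier G"
  shows "commutator G a b = inv a \<otimes> conj_by a b"
  using assms by (simp add: commutator_def m_assoc)

lemma commutator_eq_one_if_central:
  assumes "a \<in> group_center G" "g \<in> carrier G"
  shows "commutator G a g = \<one>"
proof -
  have "a \<in> carrier G" using assms by (simp add: group_center_def centralizer_def)
  then show ?thesis
    using assms by (simp add: commutator_eq_iff group_center_commute[OF assms])
qed

section \<open>Counting conjugates\<close>

text \<open>Two elements that conjugate \<open>y\<close> to the same element differ by a left factor from its
centralizer. This is one half of the orbit-stabilizer theorem, and it survives for a set \<open>P\<close> that
need not be a subgroup.\<close>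
lemma card_le_conjugates_times_centralizer:
  assumes fin: "finite (carrier G)" and y: "y \<in> carrier G" and P: "P \<subseteq> carrier G"
  shows "card P \<le> card (conj_by y ` P) * card (centralizer G {y})"
proof -
  have finP: "finite P" using P fin finite_subset by blast
  have finC: "finite (centralizer G {y})"
    using fin by (simp add: centralizer_def)
  have fibre: "card {p \<in> P. conj_by y p = k} \<le> card (centralizer G {y})"
    if k: "k \<in> conj_by y ` P" for k
  proof -
    obtain q where q: "q \<in> P" "k = conj_by y q" using k by blast
    then have qc: "q \<in> carrier G" using P by blast
    have "p \<otimes> inv q \<in> centralizer G {y}" if p: "p \<in> P" "conj_by y p = k" for p
    proof -
      have pG: "p \<in> carrier G" using p P by blast
      have "conj_by y (p \<otimes> inv q) = conj_by (conj_by y q) (inv q)"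
        using y pG qc p q by (simp only: conj_by_mult inv_closed)
      then show ?thesis
        using y pG qc mem_centralizer_singleton_iff conj_by_inv_cancel by simp
    qed
    then have "(\<lambda>p. p \<otimes> inv q) ` {p \<in> P. conj_by y p = k} \<subseteq> centralizer G {y}"
      by blast
    moreover have "inj_on (\<lambda>p. p \<otimes> inv q) {p \<in> P. conj_by y p = k}"
    proof (rule inj_onI)
      fix a b
      assume "a \<in> {p \<in> P. conj_by y p = k}" "b \<in> {p \<in> P. conj_by y p = k}"
        and eq: "a \<otimes> inv q = b \<otimes> inv q"
      then have "a \<in> carrier G" "b \<in> carrier G" using P by blast+
      then show "a = b" using eq qc by simp
    qed
    ultimately show ?thesis
      using finC card_inj_on_le by blast
  qed
  have "card P = (\<Sum>k \<in> conj_by y ` P. card {p \<in> P. conj_by y p = k})"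
    using sum.image_gen[OF finP, of "\<lambda>_. 1::nat" "conj_by y"] by simp
  also have "\<dots> \<le> card (conj_by y ` P) * card (centralizer G {y})"
    using sum_bounded_above[of "conj_by y ` P", OF fibre] by simp
  finally show ?thesis .
qed

text \<open>The other half: with a chosen \<open>r k\<close> that conjugates \<open>x\<close> to \<open>k\<close>, both \<open>k\<close> and \<open>c\<close> can be read
off from the product of \<open>c\<close> and \<open>r k\<close>, since \<open>k\<close> is the conjugate of \<open>x\<close> by that product.\<close>
lemma centralizer_times_conjugates_le_card:
  assumes fin: "finite P" and x: "x \<in> carrier G" and F: "F \<subseteq> carrier G"
    and P: "\<And>c f. c \<in> centralizer G {x} \<Longrightarrow> f \<in> F \<Longrightarrow> c \<otimes> f \<in> P"
  shows "card (centralizer G {x}) * card (conj_by x ` F) \<le> card P"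
proof -
  obtain r where r: "\<And>k. k \<in> conj_by x ` F \<Longrightarrow> r k \<in> F \<and> conj_by x (r k) = k"
    by (metis (no_types, lifting) image_iff)
  let ?m = "\<lambda>(c, k). c \<otimes> r k"
  let ?D = "centralizer G {x} \<times> conj_by x ` F"
  have conj: "conj_by x (c \<otimes> r k) = k"
    if "c \<in> centralizer G {x}" "k \<in> conj_by x ` F" for c k
    using that r[of k] F x by (auto simp: mem_centralizer_singleton_iff conj_by_mult)
  have "inj_on ?m ?D"
  proof (rule inj_onI)
    fix p q assume pq: "p \<in> ?D" "q \<in> ?D" "?m p = ?m q"
    obtain c k c' k' where p: "p = (c, k)" and q: "q = (c', k')" by (metis surj_pair)
    have c: "c \<in> centralizer G {x}" "c' \<in> centralizer G {x}"
      and k: "k \<in> conj_by x ` F" "k' \<in> conj_by x ` F" and eq: "c \<otimes> r k = c' \<otimes> r k'"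
      using pq p q by auto
    have "k = k'" using conj[OF c(1) k(1)] conj[OF c(2) k(2)] eq by simp
    moreover have "c \<in> carrier G" "c' \<in> carrier G" "r k \<in> carrier G"
      using c r[OF k(1)] F by (auto simp: centralizer_def)
    ultimately show "p = q" using eq p q by simp
  qed
  moreover have "?m ` ?D \<subseteq> P" using P r by auto
  ultimately have "card ?D \<le> card P" using fin card_inj_on_le by blast
  then show ?thesis by (simp add: card_cartesian_product)
qed

lemma card_conj_class_times_centralizer:
  assumes fin: "finite (carrier G)" and x: "x \<in> carrier G"
  shows "card (conj_class G x) * card (centralizer G {x}) = card (carrier G)"
proof (rule antisym)
  show "card (conj_class G x) * card (centralizer G {x}) \<le> card (carrier G)"
    using centralizer_times_conjugates_le_card[OF fin x subset_refl]
    by (simp add: conj_class_def centralizer_def mult.commute)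
  show "card (carrier G) \<le> card (conj_class G x) * card (centralizer G {x})"
    using card_le_conjugates_times_centralizer[OF fin x subset_refl]
    by (simp add: conj_class_def)
qed

text \<open>A non-central commutator \<open>y = [x, f]\<close> would have a larger centralizer than \<open>x\<close>: the set \<open>P\<close>,
the product of the centralizer of \<open>x\<close> with \<open>F\<close>, is too large for an orbit inside
\<open>[x, F] - {1}\<close>. For abelian \<open>F\<close> the set \<open>[x, F]\<close> is automatically normal in \<open>F\<close>, so the
assumption on it replaces commutativity.\<close>
lemma commutator_with_small_element_central:
  assumes fin: "finite (carrier G)" and small: "small_element G x" and F: "F \<lhd> G"
    and normal: "normal_subset G F (commutator_set G x F)" and f: "f \<in> F"
  shows "commutator G x f \<in> group_center G"
proof (rule ccontr)
  let ?K = "commutator_set G x F"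
  let ?C = "centralizer G {x}"
  define y where "y = commutator G x f"
  define P where "P = {c \<otimes> h |c h. c \<in> ?C \<and> h \<in> F}"
  interpret F: normal F G by fact
  assume "commutator G x f \<notin> group_center G"
  then have noncentral: "y \<notin> group_center G" by (simp add: y_def)
  have x: "x \<in> carrier G" using small by (simp add: small_element_def)
  have y: "y \<in> carrier G" using x f F.subset by (auto simp: y_def)
  have P: "P \<subseteq> carrier G" by (auto simp: P_def centralizer_def F.mem_carrier)
  have finP: "finite P" using P fin finite_subset by blast
  have finK: "finite ?K"
    using fin F.subset finite_subset unfolding commutator_set_def by blast
  \<comment> \<open>\<open>K\<close> is the left translate by \<open>inv x\<close> of the set of conjugates of \<open>x\<close> under \<open>F\<close>.\<close>
  have cardK: "card (conj_by x ` F) = card ?K"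
  proof -
    have "?K = (\<lambda>k. inv x \<otimes> k) ` conj_by x ` F"
      using x F.mem_carrier by (auto simp: commutator_set_def image_image commutator_eq_conj_by)
    moreover have "inj_on (\<lambda>k. inv x \<otimes> k) (conj_by x ` F)"
      using x F.mem_carrier by (auto intro!: inj_onI)
    ultimately show ?thesis by (simp add: card_image)
  qed
  \<comment> \<open>Leaving out \<open>\<one>\<close> is what makes the count strict.\<close>
  have orbit: "conj_by y ` P \<subseteq> ?K - {\<one>}"
  proof
    fix w assume "w \<in> conj_by y ` P"
    then obtain c h where c: "c \<in> ?C" and h: "h \<in> F" and w: "w = conj_by y (c \<otimes> h)"
      by (auto simp: P_def)
    have cG: "c \<in> carrier G" "conj_by x c = x"
      using c x mem_centralizer_singleton_iff by auto
    have hG: "h \<in> carrier G" using h by (rule F.mem_carrier)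
    have "conj_by y c = commutator G x (conj_by f c)"
      using cG x f by (simp add: y_def commutator_conj_by F.mem_carrier)
    moreover have "conj_by f c \<in> F" using f cG F.inv_op_closed1 by simp
    ultimately have "conj_by y c \<in> ?K" by (simp add: commutator_set_def)
    moreover have "w = conj_by (conj_by y c) h"
      using w y cG hG by (simp only: conj_by_mult)
    ultimately have "w \<in> ?K"
      using normal h unfolding normal_subset_def by blast
    moreover have "w \<noteq> \<one>"
    proof
      assume "w = \<one>"
      have "y = conj_by w (inv (c \<otimes> h))"
        unfolding w using y cG hG conj_by_inv_cancel[of y "c \<otimes> h"] by simp
      also have "\<dots> = \<one>" using \<open>w = \<one>\<close> cG hG by (simp add: word_simps)
      finally show False
        using noncentral subgroup.one_closed[OF subgroup_group_center] by simp
    qed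
    ultimately show "w \<in> ?K - {\<one>}" by blast
  qed
  have "commutator G x \<one> = \<one>" using x by (simp add: commutator_def)
  then have oneK: "\<one> \<in> ?K"
    unfolding commutator_set_def using F.one_closed by (metis imageI)
  have Kpos: "card ?K > 0" using oneK finK card_gt_0_iff by blast
  have "card ?C * card ?K \<le> card P"
    using centralizer_times_conjugates_le_card[OF finP x F.subset] cardK
    by (auto simp: P_def)
  also have "\<dots> \<le> card (conj_by y ` P) * card (centralizer G {y})"
    by (rule card_le_conjugates_times_centralizer[OF fin y P])
  also have "\<dots> \<le> (card ?K - 1) * card (centralizer G {y})"
    using card_mono[OF _ orbit] finK oneK by simp
  finally have le: "card ?C * card ?K \<le> (card ?K - 1) * card (centralizer G {y})" .
  have Cpos: "card ?C > 0"
  proof -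
    have "\<one> \<in> ?C" using x by (simp add: centralizer_def)
    moreover have "finite ?C" using fin by (simp add: centralizer_def)
    ultimately show ?thesis using card_gt_0_iff by blast
  qed
  have less: "card ?C < card (centralizer G {y})"
  proof (rule ccontr)
    assume "\<not> card ?C < card (centralizer G {y})"
    then have "(card ?K - 1) * card (centralizer G {y}) \<le> (card ?K - 1) * card ?C"
      by simp
    with le have "card ?C * card ?K \<le> (card ?K - 1) * card ?C"
      by (rule le_trans)
    also have "\<dots> < card ?K * card ?C"
      using Kpos Cpos by simp
    finally show False by (simp add: mult.commute)
  qed
  have "card (conj_class G x) \<le> card (conj_class G y)"
    using small y noncentral by (simp add: small_element_def)
  moreover have "card (conj_class G x) > 0"
    using fin by (auto simp: conj_class_def card_gt_0_iff)
  ultimately have "card (conj_class G x) * card ?C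
      < card (conj_class G y) * card (centralizer G {y})"
    using less by (intro mult_le_less_imp_less) auto
  then show False
    using card_conj_class_times_centralizer[OF fin x] card_conj_class_times_centralizer[OF fin y]
    by simp
qed

section \<open>The centralizer of a subgroup modulo the center\<close>

text \<open>If \<open>H\<close> is a subgroup, this is the preimage in \<open>G\<close> of the centralizer of the image of \<open>H\<close> in
the quotient of \<open>G\<close> by its center.\<close>
definition centralizer_mod_center :: "'a set \<Rightarrow> 'a set" where
  "centralizer_mod_center H = {g \<in> carrier G. \<forall>h \<in> H. commutator G g h \<in> group_center G}"

lemma subgroup_centralizer_mod_center:
  assumes H: "H \<subseteq> carrier G"
  shows "subgroup (centralizer_mod_center H) G"
proof (rule subgroupI)
  interpret Z: subgroup "group_center G" G by (rule subgroup_group_center)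
  show "centralizer_mod_center H \<subseteq> carrier G" by (auto simp: centralizer_mod_center_def)
  have "commutator G \<one> h = \<one>" if "h \<in> H" for h
    using that H by (auto simp: commutator_eq_iff)
  then show "centralizer_mod_center H \<noteq> {}"
    by (auto simp: centralizer_mod_center_def intro!: exI[of _ \<one>])
  fix a assume a: "a \<in> centralizer_mod_center H"
  then have aG: "a \<in> carrier G" by (simp add: centralizer_mod_center_def)
  {
    have "commutator G (inv a) h \<in> group_center G" if "h \<in> H" for h
    proof -
      let ?z = "commutator G a h"
      have h: "h \<in> carrier G" using that H by blast
      have z: "?z \<in> group_center G" using a that by (simp add: centralizer_mod_center_def)
      then have "inv ?z \<in> group_center G" by simp
      moreover have "commutator G (inv a) h = conj_by (inv ?z) (inv a)"
        using aG h by (simp add: commutator_def word_simps)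
      ultimately show ?thesis
        using aG by (simp only: group_center_conj_by inv_closed)
    qed
    then show "inv a \<in> centralizer_mod_center H"
      using aG by (simp add: centralizer_mod_center_def)
  next
    fix b assume b: "b \<in> centralizer_mod_center H"
    then have bG: "b \<in> carrier G" by (simp add: centralizer_mod_center_def)
    have "commutator G (a \<otimes> b) h \<in> group_center G" if "h \<in> H" for h
    proof -
      have h: "h \<in> carrier G" using that H by blast
      have "commutator G (a \<otimes> b) h = conj_by (commutator G a h) b \<otimes> commutator G b h"
        using aG bG h by (simp add: commutator_def word_simps)
      then show ?thesis
        using a b bG that by (simp add: centralizer_mod_center_def group_center_conj_by)
    qed
    then show "a \<otimes> b \<in> centralizer_mod_center H"
      using aG bG by (simp add: centralizer_mod_center_def)
  }
qed

lemma normal_centralizer_mod_center: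
  assumes "H \<lhd> G"
  shows "centralizer_mod_center H \<lhd> G"
proof (rule normal_invI)
  interpret H: normal H G by fact
  show "subgroup (centralizer_mod_center H) G"
    by (rule subgroup_centralizer_mod_center[OF H.subset])
  fix g s assume g: "g \<in> carrier G" and s: "s \<in> centralizer_mod_center H"
  have sG: "s \<in> carrier G" using s by (simp add: centralizer_mod_center_def)
  have "commutator G (g \<otimes> s \<otimes> inv g) h \<in> group_center G" if h: "h \<in> H" for h
  proof -
    have "conj_by h g \<in> H" using h g by (rule H.inv_op_closed1[rotated])
    then have z: "commutator G s (conj_by h g) \<in> group_center G"
      using s by (simp add: centralizer_mod_center_def)
    have "commutator G (g \<otimes> s \<otimes> inv g) h = conj_by (commutator G s (conj_by h g)) (inv g)"
      using sG g H.mem_carrier[OF h] by (simp add: commutator_def word_simps)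
    then show ?thesis using z g by (simp only: group_center_conj_by inv_closed)
  qed
  then show "g \<otimes> s \<otimes> inv g \<in> centralizer_mod_center H"
    using g sG by (simp add: centralizer_mod_center_def)
qed

text \<open>Conjugating \<open>a\<close> and \<open>b\<close> by \<open>h\<close> multiplies them by central elements, and a commutator does not
change when its entries are multiplied by central elements. So conjugation by \<open>h\<close> fixes
\<open>[a, b]\<close>. This is the three subgroups lemma in the only case that matters here.\<close>
lemma commutator_centralizes:
  assumes H: "H \<subseteq> carrier G"
    and a: "a \<in> centralizer_mod_center H" and b: "b \<in> centralizer_mod_center H"
  shows "commutator G a b \<in> centralizer G H"
proof -
  interpret Z: subgroup "group_center G" G by (rule subgroup_group_center)
  have G: "a \<in> carrier G" "b \<in> carrier G"
    using a b by (auto simp: centralizer_mod_center_def)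
  have "commutator G a b \<otimes> h = h \<otimes> commutator G a b" if "h \<in> H" for h
  proof -
    have h: "h \<in> carrier G" using that H by blast
    define y z where "y = commutator G a h" and "z = commutator G b h"
    have yz: "y \<in> group_center G" "z \<in> group_center G"
      using a b that by (auto simp: y_def z_def centralizer_mod_center_def)
    then have yzG: "y \<in> carrier G" "z \<in> carrier G" by auto
    have ca: "conj_by a h = a \<otimes> y"
      using G h by (simp add: y_def commutator_eq_conj_by word_simps)
    have cb: "conj_by b h = b \<otimes> z"
      using G h by (simp add: z_def commutator_eq_conj_by word_simps)
    have "conj_by (commutator G a b) h = commutator G (a \<otimes> y) (b \<otimes> z)"
      using G h by (simp only: commutator_conj_by ca cb)
    also have "\<dots> = commutator G a b"
    proof -
      have "a \<otimes> y \<otimes> (b \<otimes> z) = a \<otimes> b \<otimes> (y \<otimes> z)"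
        using G yzG group_center_commute[OF yz(1) G(2)] by (metis m_assoc m_closed)
      moreover have "b \<otimes> z \<otimes> (a \<otimes> y) = b \<otimes> a \<otimes> (y \<otimes> z)"
        using G yzG group_center_commute[OF yz(2)] by (metis m_assoc m_closed)
      moreover have "a \<otimes> b = b \<otimes> a \<otimes> commutator G a b"
        using commutator_eq_iff[of a b "commutator G a b"] G by simp
      moreover have "(y \<otimes> z) \<otimes> commutator G a b = commutator G a b \<otimes> (y \<otimes> z)"
        using yz G by (intro group_center_commute) auto
      ultimately have "a \<otimes> y \<otimes> (b \<otimes> z) = b \<otimes> z \<otimes> (a \<otimes> y) \<otimes> commutator G a b"
        using G yzG by (simp add: m_assoc)
      then show ?thesis using G yzG by (subst commutator_eq_iff) auto
    qed
    finally show ?thesis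
      using G h by (metis commutator_closed conj_by_inv_cancel inv_closed inv_solve_left m_assoc m_closed)
  qed
  then show ?thesis using G by (simp add: centralizer_def)
qed

section \<open>The lower central series and the Fitting subgroup\<close>

lemma normal_fitting_subgroup: "fitting_subgroup G \<lhd> G"
  unfolding fitting_subgroup_def
proof (rule normal_generateI)
  show "\<Union> {N. N \<lhd> G \<and> nilpotent_group (G\<lparr>carrier := N\<rparr>)} \<subseteq> carrier G"
    by (auto dest: normal_imp_subgroup subgroup.mem_carrier)
qed (auto dest: normal.inv_op_closed2)

lemma lower_central_subset:
  assumes "subgroup H G"
  shows "lower_central (G\<lparr>carrier := H\<rparr>) n \<subseteq> H"
proof (induction n)
  case (Suc n)
  interpret H: group "G\<lparr>carrier := H\<rparr>" by (rule subgroup_imp_group[OF assms])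
  have "{commutator (G\<lparr>carrier := H\<rparr>) a g |a g. a \<in> lower_central (G\<lparr>carrier := H\<rparr>) n \<and> g \<in> H}
      \<subseteq> carrier (G\<lparr>carrier := H\<rparr>)"
    using Suc.IH H.commutator_closed by auto
  from H.generate_incl[OF this] show ?case by simp
qed simp

text \<open>The commutators and the generated subgroup on the left are those of \<open>H\<close> as a group of its own.
This lemma allows to compute in \<open>G\<close> instead, and \<open>K\<close> need not lie in \<open>H\<close>.\<close>
lemma lower_central_Suc_subset:
  assumes H: "subgroup H G" and K: "subgroup K G"
    and comm: "\<And>a g. a \<in> lower_central (G\<lparr>carrier := H\<rparr>) n \<Longrightarrow> g \<in> H \<Longrightarrow> commutator G a g \<in> K"
  shows "lower_central (G\<lparr>carrier := H\<rparr>) (Suc n) \<subseteq> K"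
proof -
  let ?L = "lower_central (G\<lparr>carrier := H\<rparr>)"
  let ?T = "{commutator (G\<lparr>carrier := H\<rparr>) a g |a g. a \<in> ?L n \<and> g \<in> H}"
  interpret HG: group "G\<lparr>carrier := H\<rparr>" by (rule subgroup_imp_group[OF H])
  have eq: "commutator (G\<lparr>carrier := H\<rparr>) a g = commutator G a g" if "a \<in> H" "g \<in> H" for a g
    using that H by (simp add: commutator_def m_inv_consistent)
  have TK: "?T \<subseteq> K"
    using comm lower_central_subset[OF H, of n] by (auto simp: eq subset_iff)
  have "?T \<subseteq> H"
    using HG.commutator_closed lower_central_subset[OF H, of n] by auto
  then have "generate (G\<lparr>carrier := H\<rparr>) ?T = generate G ?T"
    by (rule generate_consistent[OF _ H])
  then show ?thesis using generate_subgroup_incl[OF TK K] by simp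
qed

lemma nilpotent_class_le:
  assumes H: "subgroup H G" and triv: "lower_central (G\<lparr>carrier := H\<rparr>) n \<subseteq> {\<one>}"
  shows "nilpotent_group (G\<lparr>carrier := H\<rparr>) \<and> nilpotency_class (G\<lparr>carrier := H\<rparr>) \<le> n"
proof -
  let ?H = "G\<lparr>carrier := H\<rparr>"
  have "\<one> \<in> lower_central ?H n"
    using subgroup.one_closed[OF H] generate.one[of ?H] by (cases n) auto
  then have eq: "lower_central ?H n = {\<one>\<^bsub>?H\<^esub>}" using triv by auto
  moreover have "group ?H" by (rule subgroup_imp_group[OF H])
  ultimately show ?thesis
    unfolding nilpotent_group_def nilpotency_class_def by (auto intro: Least_le)
qed

lemma nilpotent_normal_subset_fitting:
  assumes "N \<lhd> G" "nilpotent_group (G\<lparr>carrier := N\<rparr>)"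
  shows "N \<subseteq> fitting_subgroup G"
  unfolding fitting_subgroup_def using assms by (auto intro: generate.incl)

lemma lower_central_Suc_trivial:
  assumes H: "subgroup H G"
    and central: "lower_central (G\<lparr>carrier := H\<rparr>) n \<subseteq> group_center G"
  shows "lower_central (G\<lparr>carrier := H\<rparr>) (Suc n) \<subseteq> {\<one>}"
  using central subgroup.mem_carrier[OF H]
  by (intro lower_central_Suc_subset[OF H triv_subgroup])
    (auto simp: commutator_eq_one_if_central)

text \<open>Let \<open>S\<close> be the subgroup on the left. Its derived subgroup centralizes \<open>F\<close>, so lies in \<open>F\<close>, so
its commutators with \<open>S\<close> are central. Hence \<open>S\<close> has class at most 3, and a nilpotent normal
subgroup is contained in \<open>F\<close>.\<close>
lemma centralizer_mod_center_fitting_subset: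
  assumes CF: "centralizer G (fitting_subgroup G) \<subseteq> fitting_subgroup G"
  shows "centralizer_mod_center (fitting_subgroup G) \<subseteq> fitting_subgroup G"
proof (rule nilpotent_normal_subset_fitting)
  let ?F = "fitting_subgroup G"
  let ?S = "centralizer_mod_center ?F"
  let ?L = "lower_central (G\<lparr>carrier := ?S\<rparr>)"
  interpret Z: subgroup "group_center G" G by (rule subgroup_group_center)
  interpret F: normal ?F G by (rule normal_fitting_subgroup)
  show "?S \<lhd> G" by (rule normal_centralizer_mod_center[OF normal_fitting_subgroup])
  then have S: "subgroup ?S G" by (rule normal_imp_subgroup)
  have "?L (Suc 0) \<subseteq> centralizer G ?F"
    using commutator_centralizes[OF F.subset]
    by (intro lower_central_Suc_subset[OF S subgroup_centralizer[OF F.subset]]) auto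
  then have LF: "?L (Suc 0) \<subseteq> ?F" using CF by blast
  have "?L (Suc (Suc 0)) \<subseteq> group_center G"
  proof (rule lower_central_Suc_subset[OF S subgroup_group_center])
    fix a g assume "a \<in> ?L (Suc 0)" and g: "g \<in> ?S"
    then have a: "a \<in> ?F" using LF by blast
    have "g \<in> carrier G" "commutator G g a \<in> group_center G"
      using g a by (auto simp: centralizer_mod_center_def)
    then show "commutator G a g \<in> group_center G"
      using commutator_swap[of g a] a F.mem_carrier by simp
  qed
  from lower_central_Suc_trivial[OF S this] show "nilpotent_group (G\<lparr>carrier := ?S\<rparr>)"
    using nilpotent_class_le[OF S] by blast
qed

end

section \<open>The subgroup generated by the small elements\<close>

theorem theoremA:
  fixes G :: "('a, 'b) monoid_scheme"
  assumes "group G" and "finite (carrier G)"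
    and "centralizer G (fitting_subgroup G) \<subseteq> fitting_subgroup G"
    and "\<And>x. small_element G x \<Longrightarrow>
           normal_subset G (fitting_subgroup G) (commutator_set G x (fitting_subgroup G))"
  shows "nilpotent_group (G\<lparr>carrier := small_subgroup G\<rparr>) \<and>
         nilpotency_class (G\<lparr>carrier := small_subgroup G\<rparr>) \<le> 2"
proof -
  interpret group G by fact
  let ?F = "fitting_subgroup G"
  let ?M = "small_subgroup G"
  let ?S = "centralizer_mod_center ?F"
  have small: "{x. small_element G x} \<subseteq> ?S"
    using commutator_with_small_element_central[OF assms(2) _ normal_fitting_subgroup assms(4)]
    by (auto simp: centralizer_mod_center_def small_element_def)
  have S: "subgroup ?S G"
    by (rule normal_imp_subgroup[OF normal_centralizer_mod_center[OF normal_fitting_subgroup]])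
  have M: "subgroup ?M G"
    unfolding small_subgroup_def
    by (rule generate_is_subgroup) (auto simp: small_element_def)
  have MS: "?M \<subseteq> ?S"
    unfolding small_subgroup_def by (rule generate_subgroup_incl[OF small S])
  then have MF: "?M \<subseteq> ?F"
    using centralizer_mod_center_fitting_subset[OF assms(3)] by blast
  \<comment> \<open>The left entry of a commutator of \<open>M\<close> is taken in \<open>S\<close>, the right one in \<open>F\<close>.\<close>
  have "lower_central (G\<lparr>carrier := ?M\<rparr>) (Suc 0) \<subseteq> group_center G"
    using MS MF
    by (intro lower_central_Suc_subset[OF M subgroup_group_center])
      (auto simp: centralizer_mod_center_def)
  from lower_central_Suc_trivial[OF M this] show ?thesis
    using nilpotent_class_le[OF M, of 2] by (simp add: numeral_2_eq_2)
qed

end
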